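(* Let $A$ be a normed algebra. If $A$ has a right (resp. left) approximate identity bounded by $1$, then $A$ is left (resp. right) stable.
   Context: A normed algebra is an associative complex algebra with a norm satisfying $\|ab\|\le\|a\|\,\|b\|$ (not necessarily complete or unital). A net $(e_\lambda)_{\lambda\in\Lambda}$ in $A$ is a left (resp. right) approximate identity if $\lim_\lambda e_\lambda x=x$ (resp. $\lim_\lambda x e_\lambda=x$) for all $x\in A$; it is bounded by $1$ (has bound $1$) if $\|e_\lambda\|\le 1$ for all $\lambda$. A normed algebra $A$ is left (resp. right) stable if for every $a\in A$ and every real $M>0$: whenever $\|ab\|\le M\|b\|$ (resp. $\|ba\|\le M\|b\|$) for all $b\in A$, then $\|a\|\le M$. *)

theory Defs
  imports "HOL-Analysis.Analysis"
begin

text \<open>The library only provides real normed algebras. A complex scalar multiplication is added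
  that extends the real one; the last axiom upgrades the homogeneity of the norm from real to
  complex scalars. As in \<^class>\<open>real_normed_algebra\<close>, neither a unit nor completeness is assumed.\<close>

class scaleC =
  fixes scaleC :: "complex \<Rightarrow> 'a \<Rightarrow> 'a"  (infixr \<open>*\<^sub>C\<close> 75)

class complex_normed_algebra = scaleC + real_normed_algebra +
  assumes scaleC_add_right: "a *\<^sub>C (x + y) = a *\<^sub>C x + a *\<^sub>C y"
    and scaleC_add_left: "(a + b) *\<^sub>C x = a *\<^sub>C x + b *\<^sub>C x"
    and scaleC_scaleC: "a *\<^sub>C (b *\<^sub>C x) = (a * b) *\<^sub>C x"
    and scaleC_complex_of_real: "complex_of_real r *\<^sub>C x = r *\<^sub>R x"
    and mult_scaleC_left: "(a *\<^sub>C x) * y = a *\<^sub>C (x * y)"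
    and mult_scaleC_right: "x * (a *\<^sub>C y) = a *\<^sub>C (x * y)"
    and norm_scaleC: "norm (a *\<^sub>C x) = cmod a * norm x"

instantiation complex :: complex_normed_algebra
begin

definition scaleC_complex :: "complex \<Rightarrow> complex \<Rightarrow> complex"
  where "scaleC_complex a x = a * x"

instance
  by standard (auto simp: scaleC_complex_def algebra_simps scaleR_conv_of_real norm_mult)

end

text \<open>A net is a function considered on a set \<open>\<Lambda>\<close> of indices directed by a preorder \<open>le\<close>;
  antisymmetry is not required.\<close>

definition directed_set :: "'i set \<Rightarrow> ('i \<Rightarrow> 'i \<Rightarrow> bool) \<Rightarrow> bool"
  where "directed_set \<Lambda> le \<longleftrightarrow>
    \<Lambda> \<noteq> {} \<and> reflp_on \<Lambda> le \<and> transp_on \<Lambda> le \<and>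
    (\<forall>i\<in>\<Lambda>. \<forall>j\<in>\<Lambda>. \<exists>k\<in>\<Lambda>. le i k \<and> le j k)"

text \<open>The filter of tails, so that \<open>(f \<longlongrightarrow> x) (net_filter \<Lambda> le)\<close> is convergence of the net
  \<open>f\<close>.\<close>

definition net_filter :: "'i set \<Rightarrow> ('i \<Rightarrow> 'i \<Rightarrow> bool) \<Rightarrow> 'i filter"
  where "net_filter \<Lambda> le = (INF i\<in>\<Lambda>. principal {j \<in> \<Lambda>. le i j})"

lemma eventually_net_filter:
  assumes "directed_set \<Lambda> le"
  shows "eventually P (net_filter \<Lambda> le) \<longleftrightarrow> (\<exists>i\<in>\<Lambda>. \<forall>j\<in>\<Lambda>. le i j \<longrightarrow> P j)"
proof -
  have "\<exists>k\<in>\<Lambda>. principal {l \<in> \<Lambda>. le k l} \<le>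
      inf (principal {l \<in> \<Lambda>. le i l}) (principal {l \<in> \<Lambda>. le j l})"
    if "i \<in> \<Lambda>" "j \<in> \<Lambda>" for i j
  proof -
    obtain k where k: "k \<in> \<Lambda>" "le i k" "le j k"
      using assms \<open>i \<in> \<Lambda>\<close> \<open>j \<in> \<Lambda>\<close> unfolding directed_set_def by blast
    have "le i l \<and> le j l" if "l \<in> \<Lambda>" "le k l" for l
      using assms k \<open>i \<in> \<Lambda>\<close> \<open>j \<in> \<Lambda>\<close> that unfolding directed_set_def transp_on_def by blast
    then show ?thesis
      using k(1) by (intro bexI[of _ k]) auto
  qed
  moreover have "\<Lambda> \<noteq> {}"
    using assms by (simp add: directed_set_def)
  ultimately have "eventually P (net_filter \<Lambda> le) \<longleftrightarrow>
      (\<exists>i\<in>\<Lambda>. eventually P (principal {j \<in> \<Lambda>. le i j}))"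
    unfolding net_filter_def by (intro eventually_INF_base) auto
  then show ?thesis
    by (auto simp: eventually_principal)
qed

lemma tendsto_net_filter_iff:
  fixes f :: "'i \<Rightarrow> 'a::real_normed_vector"
  assumes "directed_set \<Lambda> le"
  shows "(f \<longlongrightarrow> x) (net_filter \<Lambda> le) \<longleftrightarrow>
    (\<forall>\<epsilon>>0. \<exists>i\<in>\<Lambda>. \<forall>j\<in>\<Lambda>. le i j \<longrightarrow> norm (f j - x) < \<epsilon>)"
  by (simp add: tendsto_iff eventually_net_filter[OF assms] dist_norm)

definition left_approximate_identity ::
    "'i set \<Rightarrow> ('i \<Rightarrow> 'i \<Rightarrow> bool) \<Rightarrow> ('i \<Rightarrow> 'a::complex_normed_algebra) \<Rightarrow> bool"
  where "left_approximate_identity \<Lambda> le e \<longleftrightarrow>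
    directed_set \<Lambda> le \<and> (\<forall>x. ((\<lambda>i. e i * x) \<longlongrightarrow> x) (net_filter \<Lambda> le))"

definition right_approximate_identity ::
    "'i set \<Rightarrow> ('i \<Rightarrow> 'i \<Rightarrow> bool) \<Rightarrow> ('i \<Rightarrow> 'a::complex_normed_algebra) \<Rightarrow> bool"
  where "right_approximate_identity \<Lambda> le e \<longleftrightarrow>
    directed_set \<Lambda> le \<and> (\<forall>x. ((\<lambda>i. x * e i) \<longlongrightarrow> x) (net_filter \<Lambda> le))"

definition net_bounded_by :: "'i set \<Rightarrow> ('i \<Rightarrow> 'a::real_normed_vector) \<Rightarrow> real \<Rightarrow> bool"
  where "net_bounded_by \<Lambda> e C \<longleftrightarrow> (\<forall>i\<in>\<Lambda>. norm (e i) \<le> C)"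

definition left_stable :: "'a::complex_normed_algebra itself \<Rightarrow> bool"
  where "left_stable (_ :: 'a itself) \<longleftrightarrow>
    (\<forall>(a::'a) M::real. M > 0 \<longrightarrow> (\<forall>b. norm (a * b) \<le> M * norm b) \<longrightarrow> norm a \<le> M)"

definition right_stable :: "'a::complex_normed_algebra itself \<Rightarrow> bool"
  where "right_stable (_ :: 'a itself) \<longleftrightarrow>
    (\<forall>(a::'a) M::real. M > 0 \<longrightarrow> (\<forall>b. norm (b * a) \<le> M * norm b) \<longrightarrow> norm a \<le> M)"

end

theory Submission
  imports Defs
begin

text \<open>Test the stability hypothesis on the approximate identity itself. Taking b =
  \<open>e i\<close> gives norm (\<open>a * e i\<close>) \<le> M * norm (\<open>e i\<close>) \<le>
  M, and \<open>a * e i\<close> tends to \<open>a\<close>. Closed balls are closed under limits of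
  nets (\<open>norm_net_limit_le\<close>), so norm \<open>a\<close> \<le> M. The other side is the
  mirror image, with \<open>e i * a\<close>.\<close>

lemma norm_net_limit_le:
  fixes f :: "'i \<Rightarrow> 'a::real_normed_vector"
  assumes dir: "directed_set \<Lambda> le"
    and lim: "(f \<longlongrightarrow> x) (net_filter \<Lambda> le)"
    and bound: "\<And>i. i \<in> \<Lambda> \<Longrightarrow> norm (f i) \<le> M"
  shows "norm x \<le> M"
proof (rule tendsto_upperbound)
  show "((\<lambda>i. norm (f i)) \<longlongrightarrow> norm x) (net_filter \<Lambda> le)"
    using lim by (rule tendsto_norm)
  show "eventually (\<lambda>i. norm (f i) \<le> M) (net_filter \<Lambda> le)"
    using dir bound by (auto simp: eventually_net_filter directed_set_def)
  \<comment> \<open>Bounds pass to the limit only along a proper filter. No tail is empty: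
    directedness, applied to an index paired with itself, yields an index above it.\<close>
  show "net_filter \<Lambda> le \<noteq> bot"
    using dir eventually_net_filter[OF dir, of "\<lambda>_. False"]
    unfolding trivial_limit_def directed_set_def by blast
qed

theorem proposition2p6:
  fixes \<Lambda> :: "'i set" and le :: "'i \<Rightarrow> 'i \<Rightarrow> bool"
    and e :: "'i \<Rightarrow> 'a::complex_normed_algebra"
  shows "(right_approximate_identity \<Lambda> le e \<and> net_bounded_by \<Lambda> e 1 \<longrightarrow> left_stable TYPE('a)) \<and>
         (left_approximate_identity \<Lambda> le e \<and> net_bounded_by \<Lambda> e 1 \<longrightarrow> right_stable TYPE('a))"
proof (intro conjI impI; elim conjE)
  \<comment> \<open>The bound 1 on the net is what makes the estimate return exactly M; a bound C
    would only give C * M.\<close>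
  have scaled: "M * norm (e i) \<le> M"
    if "net_bounded_by \<Lambda> e 1" "M > 0" "i \<in> \<Lambda>" for M i
    using that mult_left_mono[of "norm (e i)" 1 M] by (simp add: net_bounded_by_def)
  show "left_stable TYPE('a)"
    if "right_approximate_identity \<Lambda> le e" "net_bounded_by \<Lambda> e 1"
    unfolding left_stable_def
  proof (intro allI impI)
    fix a :: 'a and M :: real
    assume "M > 0" and "\<forall>b. norm (a * b) \<le> M * norm b"
    \<comment> \<open>Specialise the hypothesis to b = \<open>e i\<close>, then apply
      \<open>scaled\<close>.\<close>
    then have "norm (a * e i) \<le> M" if "i \<in> \<Lambda>" for i
      using scaled[OF \<open>net_bounded_by \<Lambda> e 1\<close> \<open>M > 0\<close> that] order_trans by blast
    then show "norm a \<le> M"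
      using that(1) unfolding right_approximate_identity_def
      by (blast intro: norm_net_limit_le)
  qed
  show "right_stable TYPE('a)"
    if "left_approximate_identity \<Lambda> le e" "net_bounded_by \<Lambda> e 1"
    unfolding right_stable_def
  proof (intro allI impI)
    fix a :: 'a and M :: real
    assume "M > 0" and "\<forall>b. norm (b * a) \<le> M * norm b"
    \<comment> \<open>Again b = \<open>e i\<close>, now multiplying from the left, where
      \<open>e i * a\<close> tends to \<open>a\<close>.\<close>
    then have "norm (e i * a) \<le> M" if "i \<in> \<Lambda>" for i
      using scaled[OF \<open>net_bounded_by \<Lambda> e 1\<close> \<open>M > 0\<close> that] order_trans by blast
    then show "norm a \<le> M"
      using that(1) unfolding left_approximate_identity_def
      by (blast intro: norm_net_limit_le)
  qed
qed

end
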